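(* Let $q$ be a square-free positive integer and let $A\subseteq\mathbb{Z}_q^{\ast}$ satisfy $|A|>\frac12\varphi(q)$, where $\varphi$ is Euler's totient function. Then $$A+A+A+A=\{a\in\mathbb{Z}_q:\ a\equiv 0 \pmod{(2,q)}\}.$$
   Context: $\mathbb{Z}_q=\mathbb{Z}/q\mathbb{Z}$ and $\mathbb{Z}_q^{\ast}$ is its group of units. $A+A+A+A=\{a_1+a_2+a_3+a_4: a_i\in A\}$. $(2,q)$ denotes $\gcd(2,q)$; the condition $a\equiv 0 \pmod{(2,q)}$ is well defined on $\mathbb{Z}_q$ since $(2,q)\mid q$. *)

theory Defs
  imports Complex_Main
    "HOL-Number_Theory.Number_Theory"
    "HOL-Algebra.IntRing"
    "HOL-Computational_Algebra.Squarefree"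
begin

text \<open>
  \<open>\<int>/q\<int>\<close> is rendered as \<open>ZFact (int q)\<close>, whose elements are the cosets of \<open>q\<int>\<close>, and not
  as \<open>residue_ring (int q)\<close>: the latter has \<open>1\<close> as its one element even for \<open>q = 1\<close>, where its
  carrier is \<open>{0}\<close>, so that its set of units would be empty.
\<close>

end

theory Submission
  imports Defs
begin

text \<open>
  Weights replace sets: if \<open>f\<close> maps the units modulo \<open>q\<close> to \<open>[0, 1]\<close> with mean above \<open>1/2\<close>, then every
  admissible residue is a sum of four units of positive weight whose weights add up to more than \<open>2\<close>.
  This goes up from \<open>q\<close> to \<open>p q\<close>: averaging \<open>f\<close> over the fibres of reduction modulo \<open>q\<close> gives four
  units modulo \<open>q\<close> whose fibres carry four weights on the units modulo \<open>p\<close> with means adding up to more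
  than \<open>2\<close>, and it remains to solve the problem modulo \<open>p\<close> for four different weights. For \<open>p \<ge> 5\<close>
  sort each weight decreasingly and take the four top segments; by Cauchy--Davenport their sumset is
  everything once the sizes add up to \<open>p + 3\<close>, and an averaging argument over the choice of the sizes
  makes the smallest weights in the segments add up to more than \<open>2\<close>. The problem modulo \<open>3\<close> with four
  different weights can fail, so \<open>3\<close> is kept as a base case, where there is only one weight.
\<close>

section \<open>Choosing positions in four weight sequences\<close>

text \<open>In the application \<open>n = p - 1\<close> counts the units modulo \<open>p\<close>,
  \<open>s\<close> is the size of the support of a weight and \<open>h\<close> lists its values
  decreasingly; of that order only the maximum at \<open>0\<close> is recorded.\<close>

definition peaked_weights :: "nat \<Rightarrow> nat \<Rightarrow> (nat \<Rightarrow> real) \<Rightarrow> bool" where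
  "peaked_weights n s h \<longleftrightarrow> 0 < s \<and> s \<le> n \<and> (\<forall>j<s. 0 < h j \<and> h j \<le> h 0 \<and> h j \<le> 1)"

text \<open>The \<open>s - M\<close> positions before the window weigh at most \<open>1\<close>
  each. The window is listed in both directions, so that a climbing and a descending position cancel
  when positions are added.\<close>

lemma sum_le_top_window:
  fixes h :: "nat \<Rightarrow> real"
  assumes "peaked_weights n s h" "M \<le> s"
  shows "(\<Sum>j<s. h j) \<le> real s - real M + (\<Sum>a<M. h (s - M + a))"
    and "(\<Sum>j<s. h j) \<le> real s - real M + (\<Sum>a<M. h (s - 1 - a))"
proof -
  have "(\<Sum>j<s. h j) = (\<Sum>j<s - M. h j) + (\<Sum>j=s-M..<s. h j)"
    using assms(2) sum.atLeastLessThan_concat[of 0 "s - M" s h]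
    by (simp add: atLeast0LessThan)
  also have "(\<Sum>j=s-M..<s. h j) = (\<Sum>a<M. h (s - M + a))"
    using sum.shift_bounds_nat_ivl[of h 0 "s - M" M] assms(2)
    by (simp add: atLeast0LessThan add.commute)
  also have "(\<Sum>j<s - M. h j) \<le> real (s - M)"
    using sum_bounded_above[of "{..<s - M}" h 1] assms by (auto simp: peaked_weights_def)
  finally show 1: "(\<Sum>j<s. h j) \<le> real s - real M + (\<Sum>a<M. h (s - M + a))"
    using assms(2) by simp
  have "(\<Sum>a<M. h (s - M + a)) = (\<Sum>a<M. h (s - M + (M - Suc a)))"
    by (rule sum.nat_diff_reindex[symmetric])
  also have "\<dots> = (\<Sum>a<M. h (s - 1 - a))"
    using assms(2) by (intro sum.cong) auto
  finally show "(\<Sum>j<s. h j) \<le> real s - real M + (\<Sum>a<M. h (s - 1 - a))"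
    using 1 by simp
qed

lemma sum_le_mult_first:
  assumes "peaked_weights n s h"
  shows "(\<Sum>j<s. h j) \<le> real s * h 0"
  using sum_bounded_above[of "{..<s}" h "h 0"] assms by (auto simp: peaked_weights_def)

text \<open>Serves the case in which the fourth sequence is too short for the common window of
  \<open>ex_positions_sum_gt_two\<close>. The bound is averaged over choices whose fourth position
  stays at \<open>0\<close>, where the weight is largest.\<close>

lemma sum_le_two_mult_if_short:
  assumes w: "peaked_weights n s1 h1" "peaked_weights n s2 h2"
      "peaked_weights n s3 h3" "peaked_weights n s4 h4"
    and n: "3 \<le> n"
    and short: "s4 + 1 + 2 * n \<le> s1 + s2 + s3"
    and bound: "\<And>j1 j2 j3 j4. \<lbrakk>j1 < s1; j2 < s2; j3 < s3; j4 < s4; n \<le> j1 + j2 + j3 + j4\<rbrakk>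
      \<Longrightarrow> h1 j1 + h2 j2 + h3 j3 + h4 j4 \<le> 2"
  shows "(\<Sum>j<s1. h1 j) + (\<Sum>j<s2. h2 j) + (\<Sum>j<s3. h3 j) + (\<Sum>j<s4. h4 j) \<le> 2 * real n"
proof (cases "s1 = n \<and> s2 = n \<and> s3 = n")
  case False
  txt \<open>The last \<open>M\<close> positions of each of the first three sequences, the second run through backwards, while
    the fourth stays at \<open>0\<close>; the positions left out have weight at most \<open>1\<close>.\<close>
  define M where "M = s1 + s2 + s3 - 2 * n"
  have s: "0 < s1" "0 < s2" "0 < s3" "0 < s4" "s1 \<le> n" "s2 \<le> n" "s3 \<le> n" "s4 \<le> n"
    and pos: "0 < h4 0"
    using w by (auto simp: peaked_weights_def)
  have M: "M \<le> s1" "M \<le> s2" "M \<le> s3" "s4 \<le> M" "real M = real s1 + real s2 + real s3 - 2 * real n"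
    using s short by (auto simp: M_def)
  have "(\<Sum>a<M. h1 (s1 - M + a) + h2 (s2 - 1 - a) + h3 (s3 - M + a) + h4 0) \<le> real (card {..<M}) * 2"
  proof (rule sum_bounded_above)
    fix a assume "a \<in> {..<M}"
    hence a: "a < M" by simp
    \<comment> \<open>The positions add up to \<open>2 * n - M - 1 + a\<close>, and
      \<open>M < n\<close> because not all three lengths are \<open>n\<close>.\<close>
    show "h1 (s1 - M + a) + h2 (s2 - 1 - a) + h3 (s3 - M + a) + h4 0 \<le> 2"
      using a s M short False by (intro bound) (auto simp: M_def)
  qed
  hence "(\<Sum>a<M. h1 (s1 - M + a)) + (\<Sum>a<M. h2 (s2 - 1 - a)) + (\<Sum>a<M. h3 (s3 - M + a)) + M * h4 0 \<le> 2 * M"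
    by (simp add: sum.distrib)
  moreover have "(\<Sum>j<s4. h4 j) \<le> M * h4 0"
    using sum_le_mult_first[OF w(4)] mult_right_mono[of "real s4" "real M" "h4 0"] M(4) pos by linarith
  ultimately show ?thesis
    using sum_le_top_window(1)[OF w(1) M(1)] sum_le_top_window(2)[OF w(2) M(2)]
      sum_le_top_window(1)[OF w(3) M(3)] M(5) by linarith
next
  case True
  have s: "s1 = n" "s2 = n" "s3 = n" "0 < s4" "0 < n" using True n w by (auto simp: peaked_weights_def)
  have pos: "0 < h1 0" "0 < h2 0" "0 < h3 0" "0 < h4 0"
    using w by (auto simp: peaked_weights_def)
  txt \<open>With \<open>M = n\<close> the positions above could add up to \<open>n - 1\<close> only. Instead, two of the three long
    sequences run through the pairs with sum \<open>n\<close> and the others stay at \<open>0\<close>.\<close>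
  have pair: "(\<Sum>j<n. f j) - f 0 + ((\<Sum>j<n. g j) - g 0) + real (n - 1) * c \<le> 2 * real (n - 1)"
    if "\<And>a b. \<lbrakk>a < n; b < n; a + b = n\<rbrakk> \<Longrightarrow> f a + g b + c \<le> 2" for f g :: "nat \<Rightarrow> real" and c
  proof -
    have shift: "(\<Sum>j<n. f j) - f 0 = (\<Sum>a<n - 1. f (Suc a))" for f :: "nat \<Rightarrow> real"
      using sum.lessThan_Suc_shift[of f "n - 1"] n by simp
    have "(\<Sum>a<n - 1. f (Suc a)) + (\<Sum>a<n - 1. g (Suc a))
        = (\<Sum>a<n - 1. f (Suc a)) + (\<Sum>a<n - 1. g (Suc (n - 1 - Suc a)))"
      using sum.nat_diff_reindex[of "\<lambda>a. g (Suc a)" "n - 1"] by simp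
    also have "\<dots> + real (n - 1) * c = (\<Sum>a<n - 1. f (Suc a) + g (Suc (n - 1 - Suc a)) + c)"
      by (simp add: sum.distrib)
    also have "\<dots> \<le> real (card {..<n - 1}) * 2"
      by (intro sum_bounded_above that) auto
    finally show ?thesis by (simp add: shift)
  qed
  have 1: "(\<Sum>j<n. h1 j) - h1 0 + ((\<Sum>j<n. h2 j) - h2 0) + real (n - 1) * (h3 0 + h4 0) \<le> 2 * real (n - 1)"
  proof (rule pair)
    fix a b assume "a < n" "b < n" "a + b = n"
    thus "h1 a + h2 b + (h3 0 + h4 0) \<le> 2" using bound[of a b 0 0] s by simp
  qed
  have 2: "(\<Sum>j<n. h1 j) - h1 0 + ((\<Sum>j<n. h3 j) - h3 0) + real (n - 1) * (h2 0 + h4 0) \<le> 2 * real (n - 1)"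
  proof (rule pair)
    fix a b assume "a < n" "b < n" "a + b = n"
    thus "h1 a + h3 b + (h2 0 + h4 0) \<le> 2" using bound[of a 0 b 0] s by simp
  qed
  have 3: "(\<Sum>j<n. h2 j) - h2 0 + ((\<Sum>j<n. h3 j) - h3 0) + real (n - 1) * (h1 0 + h4 0) \<le> 2 * real (n - 1)"
  proof (rule pair)
    fix a b assume "a < n" "b < n" "a + b = n"
    thus "h2 a + h3 b + (h1 0 + h4 0) \<le> 2" using bound[of 0 a b 0] s by simp
  qed
  define N where "N = real (n - 1)"
  have N: "real n = N + 1" "2 \<le> N" using n by (auto simp: N_def)
  define z where "z = h1 0 + h2 0 + h3 0"
  define T where "T = (\<Sum>j<n. h1 j) + (\<Sum>j<n. h2 j) + (\<Sum>j<n. h3 j)"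
  define y where "y = h4 0"
  have A: "2 * T + (N - 2) * z + 3 * (N * y) \<le> 6 * N"
    using 1 2 3 unfolding N_def[symmetric] T_def z_def y_def by (simp add: algebra_simps)
  have B: "T \<le> (N + 1) * z"
    using sum_le_mult_first[OF w(1)] sum_le_mult_first[OF w(2)] sum_le_mult_first[OF w(3)]
    by (simp add: T_def z_def s N algebra_simps)
  have "s4 \<le> n - 1" using short s by simp
  hence "real s4 * y \<le> N * y"
    using pos by (intro mult_right_mono) (simp_all add: y_def N_def)
  hence C: "(\<Sum>j<s4. h4 j) \<le> N * y" using sum_le_mult_first[OF w(4)] by (simp add: y_def)
  have "T + N * y \<le> 2 * (N + 1)"
  proof (rule ccontr)
    assume "\<not> ?thesis"
    hence D: "T + N * y > 2 * (N + 1)" by simp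
    \<comment> \<open>\<open>N + 1\<close> times \<open>A\<close> plus \<open>N - 2\<close> times
      \<open>B\<close> eliminates \<open>z\<close>; \<open>N - 2\<close> is nonnegative by
      \<open>3 \<le> n\<close>.\<close>
    have "(N - 2) * T \<le> (N - 2) * ((N + 1) * z)" using B N by (intro mult_left_mono) auto
    hence "(2 * T + 3 * (N * y)) * (N + 1) + (N - 2) * T \<le> 6 * N * (N + 1)"
      using mult_right_mono[OF A, of "N + 1"] N by (simp add: algebra_simps)
    hence "3 * N * (T + N * y) + 3 * (N * y) \<le> 3 * N * (2 * (N + 1))" by (simp add: algebra_simps)
    moreover have "3 * N * (T + N * y) > 3 * N * (2 * (N + 1))"
      using D N by (intro mult_strict_left_mono) auto
    moreover have "N * y \<ge> 0" using N pos by (simp add: y_def)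
    ultimately show False by linarith
  qed
  thus ?thesis using C by (simp add: T_def s N)
qed

text \<open>Position \<open>j\<close> stands for a top segment of \<open>j + 1\<close> elements, so
  for \<open>n = p - 1\<close> the four sizes add up to at least \<open>p + 3\<close>. If no choice
  had weight above \<open>2\<close>, averaging over windows of a common length would contradict
  \<open>gt\<close>.\<close>

lemma ex_positions_sum_gt_two:
  assumes w: "peaked_weights n s1 h1" "peaked_weights n s2 h2"
      "peaked_weights n s3 h3" "peaked_weights n s4 h4"
    and n: "3 \<le> n"
    and gt: "(\<Sum>j<s1. h1 j) + (\<Sum>j<s2. h2 j) + (\<Sum>j<s3. h3 j) + (\<Sum>j<s4. h4 j) > 2 * real n"
  shows "\<exists>j1<s1. \<exists>j2<s2. \<exists>j3<s3. \<exists>j4<s4. n \<le> j1 + j2 + j3 + j4 \<and> h1 j1 + h2 j2 + h3 j3 + h4 j4 > 2"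
proof (rule ccontr)
  assume "\<not> ?thesis"
  hence bound: "\<And>j1 j2 j3 j4. \<lbrakk>j1 < s1; j2 < s2; j3 < s3; j4 < s4; n \<le> j1 + j2 + j3 + j4\<rbrakk>
      \<Longrightarrow> h1 j1 + h2 j2 + h3 j3 + h4 j4 \<le> 2" by force
  \<comment> \<open>The short case is excluded for each sequence in turn; the four inequalities make
    the window length \<open>M\<close> fit into every sequence.\<close>
  have long: "s1 + s2 + s3 < s4 + 1 + 2 * n"
    using sum_le_two_mult_if_short[OF w n _ bound] gt by linarith
  have "s4 + s2 + s3 < s1 + 1 + 2 * n"
  proof (rule ccontr)
    assume "\<not> ?thesis"
    hence "(\<Sum>j<s4. h4 j) + (\<Sum>j<s2. h2 j) + (\<Sum>j<s3. h3 j) + (\<Sum>j<s1. h1 j) \<le> 2 * real n"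
    proof (intro sum_le_two_mult_if_short[OF w(4,2,3,1) n])
      fix j4 j2 j3 j1 assume "j4 < s4" "j2 < s2" "j3 < s3" "j1 < s1" "n \<le> j4 + j2 + j3 + j1"
      thus "h4 j4 + h2 j2 + h3 j3 + h1 j1 \<le> 2" using bound[of j1 j2 j3 j4] by simp
    qed simp
    thus False using gt by linarith
  qed
  moreover have "s1 + s4 + s3 < s2 + 1 + 2 * n"
  proof (rule ccontr)
    assume "\<not> ?thesis"
    hence "(\<Sum>j<s1. h1 j) + (\<Sum>j<s4. h4 j) + (\<Sum>j<s3. h3 j) + (\<Sum>j<s2. h2 j) \<le> 2 * real n"
    proof (intro sum_le_two_mult_if_short[OF w(1,4,3,2) n])
      fix j1 j4 j3 j2 assume "j1 < s1" "j4 < s4" "j3 < s3" "j2 < s2" "n \<le> j1 + j4 + j3 + j2"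
      thus "h1 j1 + h4 j4 + h3 j3 + h2 j2 \<le> 2" using bound[of j1 j2 j3 j4] by simp
    qed simp
    thus False using gt by linarith
  qed
  moreover have "s1 + s2 + s4 < s3 + 1 + 2 * n"
  proof (rule ccontr)
    assume "\<not> ?thesis"
    hence "(\<Sum>j<s1. h1 j) + (\<Sum>j<s2. h2 j) + (\<Sum>j<s4. h4 j) + (\<Sum>j<s3. h3 j) \<le> 2 * real n"
    proof (intro sum_le_two_mult_if_short[OF w(1,2,4,3) n])
      fix j1 j2 j4 j3 assume "j1 < s1" "j2 < s2" "j4 < s4" "j3 < s3" "n \<le> j1 + j2 + j4 + j3"
      thus "h1 j1 + h2 j2 + h4 j4 + h3 j3 \<le> 2" using bound[of j1 j2 j3 j4] by simp
    qed simp
    thus False using gt by linarith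
  qed
  \<comment> \<open>With \<open>S = s1 + s2 + s3 + s4\<close>, this is half of
    \<open>S - 2 * n\<close> rounded up. The averaging bounds the total by \<open>S - 2 * M\<close>,
    which is at most \<open>2 * n\<close>, while the window positions have the constant sum
    \<open>S - 2 * M - 2\<close>, at least \<open>2 * n - 3\<close> and so at least
    \<open>n\<close>.\<close>
  moreover define M where "M = (s1 + s2 + s3 + s4 - 2 * n + 1) div 2"
  ultimately have M: "M \<le> s1" "M \<le> s2" "M \<le> s3" "M \<le> s4" using long by linarith+
  have T: "(\<Sum>j<s. h j) \<le> s" if "peaked_weights n s h" for s h
    using sum_bounded_above[of "{..<s}" h 1] that by (auto simp: peaked_weights_def)
  have S: "s1 + s2 + s3 + s4 > 2 * n"
    using gt T[OF w(1)] T[OF w(2)] T[OF w(3)] T[OF w(4)] by linarith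
  have M2: "s1 + s2 + s3 + s4 \<le> 2 * n + 2 * M" "2 * n + 2 * M \<le> s1 + s2 + s3 + s4 + 1"
    using S by (auto simp: M_def)
  have "(\<Sum>a<M. h1 (s1 - M + a) + h2 (s2 - 1 - a) + h3 (s3 - M + a) + h4 (s4 - 1 - a))
      \<le> real (card {..<M}) * 2"
  proof (rule sum_bounded_above)
    fix a assume "a \<in> {..<M}"
    hence a: "a < M" by simp
    show "h1 (s1 - M + a) + h2 (s2 - 1 - a) + h3 (s3 - M + a) + h4 (s4 - 1 - a) \<le> 2"
      using a M M2 n by (intro bound) linarith+
  qed
  hence "(\<Sum>a<M. h1 (s1 - M + a)) + (\<Sum>a<M. h2 (s2 - 1 - a)) + (\<Sum>a<M. h3 (s3 - M + a))
      + (\<Sum>a<M. h4 (s4 - 1 - a)) \<le> 2 * M"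
    by (simp add: sum.distrib)
  moreover have "real s1 + real s2 + real s3 + real s4 \<le> 2 * real n + 2 * real M" using M2(1) by linarith
  ultimately show False
    using gt sum_le_top_window(1)[OF w(1) M(1)] sum_le_top_window(2)[OF w(2) M(2)]
      sum_le_top_window(1)[OF w(3) M(3)] sum_le_top_window(2)[OF w(4) M(4)] by linarith
qed

section \<open>The theorem of Cauchy and Davenport\<close>

definition sumset_mod :: "int \<Rightarrow> int set \<Rightarrow> int set \<Rightarrow> int set" where
  "sumset_mod p A B = (\<lambda>(a, b). (a + b) mod p) ` (A \<times> B)"

lemma sumset_modI: "\<lbrakk>a \<in> A; b \<in> B; x = (a + b) mod p\<rbrakk> \<Longrightarrow> x \<in> sumset_mod p A B"
  by (auto simp: sumset_mod_def)

lemma sumset_mod_subset: "p > 0 \<Longrightarrow> sumset_mod p A B \<subseteq> {0..<p}"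
  by (auto simp: sumset_mod_def)

lemma inj_on_translate_mod: "A \<subseteq> {0..<p} \<Longrightarrow> inj_on (\<lambda>a. (a + c) mod p) A" for p :: int
proof (rule inj_onI)
  fix x y assume "A \<subseteq> {0..<p}" "x \<in> A" "y \<in> A" "(x + c) mod p = (y + c) mod p"
  hence "x \<in> {0..<p}" "y \<in> {0..<p}" "[x = y] (mod p)"
    by (auto simp: cong_add_rcancel simp flip: cong_def)
  thus "x = y" by (auto simp: cong_def)
qed

text \<open>\<open>d\<close> generates the additive group modulo the prime \<open>p\<close>, so the
  translates \<open>a + k * d\<close> of a single element run through all residues.\<close>

lemma full_if_closed_under_translation:
  fixes p d :: int
  assumes p: "Factorial_Ring.prime p" and A: "A \<subseteq> {0..<p}" "A \<noteq> {}" and d: "\<not> p dvd d"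
    and closed: "\<And>a. a \<in> A \<Longrightarrow> (a + d) mod p \<in> A"
  shows "A = {0..<p}"
proof
  have p0: "p > 0" using p by (simp add: prime_gt_0_int)
  obtain a where a: "a \<in> A" using A by auto
  have step: "(a + int k * d) mod p \<in> A" for k
  proof (induction k)
    case 0 thus ?case using a A by auto
  next
    case (Suc k)
    have "((a + int k * d) mod p + d) mod p = (a + int (Suc k) * d) mod p"
      by (subst mod_add_left_eq) (simp add: algebra_simps)
    thus ?case using closed[OF Suc] by simp
  qed
  have "coprime d p" using p d by (metis coprime_commute prime_imp_coprime)
  then obtain y where y: "[d * y = 1] (mod p)" using cong_solve_coprime_int by blast
  show "{0..<p} \<subseteq> A"
  proof
    fix x assume x: "x \<in> {0..<p}"
    \<comment> \<open>\<open>y\<close> inverts \<open>d\<close>, so this \<open>k\<close> solves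
      \<open>a + k * d = x\<close> modulo \<open>p\<close>.\<close>
    define k where "k = nat ((y * (x - a)) mod p)"
    have "[int k = y * (x - a)] (mod p)" using p0 by (simp add: k_def cong_def)
    hence "[a + int k * d = a + (y * (x - a)) * d] (mod p)"
      by (intro cong_add cong_mult cong_refl)
    also have "a + (y * (x - a)) * d = a + (d * y) * (x - a)" by simp
    also have "[a + (d * y) * (x - a) = a + 1 * (x - a)] (mod p)"
      by (intro cong_add cong_mult cong_refl y)
    finally have "(a + int k * d) mod p = x" using x by (simp add: cong_def)
    thus "x \<in> A" using step[of k] by simp
  qed
qed (use A in auto)

text \<open>Induction on the size of \<open>B\<close>: unless \<open>B\<close> is a singleton or
  \<open>A\<close> is everything, there is a pair of the same total size with a smaller nonempty
  second set and a sumset inside the old one.\<close>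

theorem Cauchy_Davenport:
  assumes p: "Factorial_Ring.prime p" and "A \<subseteq> {0..<p}" "B \<subseteq> {0..<p}" "A \<noteq> {}" "B \<noteq> {}"
  shows "min (nat p) (card A + card B - 1) \<le> card (sumset_mod p A B)"
  using assms(2-)
proof (induction "card B" arbitrary: A B rule: less_induct)
  case less
  have p0: "p > 0" using p by (simp add: prime_gt_0_int)
  have fin: "finite A" "finite B" "finite (sumset_mod p A B)"
    using less.prems sumset_mod_subset[OF p0, of A B] finite_subset[OF _ finite_atLeastLessThan_int]
    by blast+
  obtain b where b: "b \<in> B" using less.prems by auto
  \<comment> \<open>A translate of \<open>A\<close> lies in the sumset; this settles a singleton
    \<open>B\<close> and a full \<open>A\<close>.\<close>
  have "card A = card ((\<lambda>a. (a + b) mod p) ` A)"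
    using inj_on_translate_mod[OF less.prems(1)] by (simp add: card_image)
  also have "\<dots> \<le> card (sumset_mod p A B)"
    using b by (intro card_mono fin) (auto intro: sumset_modI)
  finally have transl: "card A \<le> card (sumset_mod p A B)" .
  consider "B = {b}" | "A = {0..<p}" | b' where "b' \<in> B" "b' \<noteq> b" "A \<noteq> {0..<p}" using b by auto
  thus ?case
  proof cases
    case 3
    have "\<not> p dvd (b' - b)"
    proof
      assume "p dvd (b' - b)"
      hence "[b' = b] (mod p)" by (simp add: cong_iff_dvd_diff)
      thus False using 3 b less.prems by (auto simp: cong_def subset_iff)
    qed
    then obtain a where a: "a \<in> A" "(a + (b' - b)) mod p \<notin> A"
      using full_if_closed_under_translation[OF p less.prems(1,3)] 3 by blast
    txt \<open>Dyson's transform: it keeps the sum of the sizes and shrinks \<open>B\<close>.\<close>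
    define e where "e = a - b"
    define A' where "A' = A \<union> (\<lambda>y. (y + e) mod p) ` B"
    define B' where "B' = {y \<in> B. (y + e) mod p \<in> A}"
    \<comment> \<open>This \<open>e\<close> keeps \<open>b\<close>, as \<open>b + e = a\<close>, and
      drops \<open>b'\<close>, which goes to \<open>a + (b' - b)\<close> outside
      \<open>A\<close>.\<close>
    have bB: "b \<in> B'" using a b less.prems by (auto simp: B'_def e_def)
    have bB': "b' \<in> B - B'" using a 3 by (auto simp: B'_def e_def algebra_simps)
    \<comment> \<open>The translates of \<open>B'\<close> are in \<open>A\<close> already and those
      of \<open>B - B'\<close> are outside, so \<open>A\<close> gains as many elements as
      \<open>B\<close> loses.\<close>
    have "card A' = card (A \<union> (\<lambda>y. (y + e) mod p) ` (B - B'))"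
      by (rule arg_cong[of _ _ card]) (auto simp: A'_def B'_def)
    also have "\<dots> = card A + card ((\<lambda>y. (y + e) mod p) ` (B - B'))"
      using fin by (intro card_Un_disjoint) (auto simp: B'_def)
    also have "card ((\<lambda>y. (y + e) mod p) ` (B - B')) = card (B - B')"
      using less.prems by (intro card_image inj_on_translate_mod) auto
    also have "card (B - B') = card B - card B'"
      using fin by (intro card_Diff_subset) (auto simp: B'_def)
    finally have cA': "card A' = card A + (card B - card B')" .
    have lt: "card B' < card B"
      using fin bB' by (intro psubset_card_mono) (auto simp: B'_def)
    have "sumset_mod p A' B' \<subseteq> sumset_mod p A B"
    proof
      fix x assume "x \<in> sumset_mod p A' B'"
      then obtain u v where uv: "u \<in> A'" "v \<in> B'" "x = (u + v) mod p"
        by (auto simp: sumset_mod_def)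
      from uv(1) consider "u \<in> A" | w where "w \<in> B" "u = (w + e) mod p" by (auto simp: A'_def)
      thus "x \<in> sumset_mod p A B"
      proof cases
        case 2
        \<comment> \<open>The shift \<open>e\<close> is moved from \<open>w\<close> to
          \<open>v\<close>: modulo \<open>p\<close>, \<open>v + e\<close> is in \<open>A\<close> as
          \<open>v\<close> is in \<open>B'\<close>, and \<open>w\<close> is in
          \<open>B\<close>.\<close>
        have "x = (w + e + v) mod p" unfolding uv(3) 2(2) by (rule mod_add_left_eq)
        also have "w + e + v = v + e + w" by simp
        also have "\<dots> mod p = ((v + e) mod p + w) mod p" by (rule mod_add_left_eq[symmetric])
        finally have "x = ((v + e) mod p + w) mod p" .
        thus ?thesis using uv 2 by (intro sumset_modI[of "(v + e) mod p" _ w]) (auto simp: B'_def)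
      qed (use uv in \<open>auto simp: B'_def intro: sumset_modI\<close>)
    qed
    hence "card (sumset_mod p A' B') \<le> card (sumset_mod p A B)" by (intro card_mono fin)
    moreover have "min (nat p) (card A' + card B' - 1) \<le> card (sumset_mod p A' B')"
      using less.prems bB p0 by (intro less.hyps lt) (auto simp: A'_def B'_def)
    ultimately show ?thesis using cA' lt by simp
  qed (use transl in \<open>auto simp: p0\<close>)
qed

text \<open>Each of three applications of \<open>Cauchy_Davenport\<close> costs \<open>1\<close>,
  which accounts for the \<open>3\<close>; a sumset of \<open>p\<close> residues contains every
  residue.\<close>

lemma ex_sum4_cong:
  fixes x :: int
  assumes p: "Factorial_Ring.prime p"
    and sub: "B1 \<subseteq> {0..<p}" "B2 \<subseteq> {0..<p}" "B3 \<subseteq> {0..<p}" "B4 \<subseteq> {0..<p}"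
    and ne: "B1 \<noteq> {}" "B2 \<noteq> {}" "B3 \<noteq> {}" "B4 \<noteq> {}"
    and card: "nat p + 3 \<le> card B1 + card B2 + card B3 + card B4"
  shows "\<exists>b1\<in>B1. \<exists>b2\<in>B2. \<exists>b3\<in>B3. \<exists>b4\<in>B4. [b1 + b2 + b3 + b4 = x] (mod p)"
proof -
  have p0: "p > 0" using p by (simp add: prime_gt_0_int)
  have fin: "finite B1" "finite B2" "finite B3" "finite B4"
    using sub by (auto intro: finite_subset)
  let ?C2 = "sumset_mod p B1 B2"
  let ?C3 = "sumset_mod p ?C2 B3"
  let ?C4 = "sumset_mod p ?C3 B4"
  have sub': "?C2 \<subseteq> {0..<p}" "?C3 \<subseteq> {0..<p}" "?C4 \<subseteq> {0..<p}"
    using sumset_mod_subset[OF p0] by auto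
  have ne': "?C2 \<noteq> {}" "?C3 \<noteq> {}" using ne by (auto simp: sumset_mod_def)
  have pos: "card B1 > 0" "card B2 > 0" "card B3 > 0" "card B4 > 0"
    using ne fin by (auto simp: card_gt_0_iff)
  have "nat p \<le> card ?C4"
    using Cauchy_Davenport[OF p sub(1,2) ne(1,2)] Cauchy_Davenport[OF p sub'(1) sub(3) ne'(1) ne(3)]
      Cauchy_Davenport[OF p sub'(2) sub(4) ne'(2) ne(4)] pos card by linarith
  hence "?C4 = {0..<p}" using sub'(3) by (intro card_seteq) auto
  hence "x mod p \<in> ?C4" using p0 by auto
  then obtain b1 b2 b3 b4 where b: "b1 \<in> B1" "b2 \<in> B2" "b3 \<in> B3" "b4 \<in> B4"
      and eq: "x mod p = (((b1 + b2) mod p + b3) mod p + b4) mod p"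
    by (auto simp: sumset_mod_def)
  have "[b1 + b2 + b3 + b4 = x] (mod p)"
    using eq by (simp add: cong_def) (metis mod_add_left_eq)
  thus ?thesis using b by blast
qed

section \<open>Four weights modulo a prime\<close>

text \<open>The induction inserts elements in order of decreasing \<open>g\<close>, so each new
  value goes to the end of \<open>h\<close> and the set built so far is its top segment
  \<open>B\<close>.\<close>

lemma ex_peaked_rearrangement:
  fixes g :: "'a \<Rightarrow> real"
  assumes "finite X"
  shows "\<exists>h. (\<Sum>j<card X. h j) = (\<Sum>x\<in>X. g x) \<and>
    (\<forall>j<card X. h j \<in> g ` X \<and> h j \<le> h 0 \<and> (\<exists>B\<subseteq>X. card B = Suc j \<and> (\<forall>b\<in>B. h j \<le> g b)))"
  using assms
proof (induction rule: finite_ranking_induct[where f = "\<lambda>x. - g x"])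
  case (insert x S)
  show ?case
  proof (cases "x \<in> S")
    case True
    thus ?thesis using insert by (simp add: insert_absorb)
  next
    case False
    let ?n = "card S"
    from insert obtain h where h: "(\<Sum>j<?n. h j) = (\<Sum>x\<in>S. g x)"
      "\<And>j. j < ?n \<Longrightarrow> h j \<in> g ` S \<and> h j \<le> h 0 \<and> (\<exists>B\<subseteq>S. card B = Suc j \<and> (\<forall>b\<in>B. h j \<le> g b))"
      by auto
    define h' where "h' = h(?n := g x)"
    have "h' j \<in> g ` insert x S \<and> h' j \<le> h' 0 \<and>
        (\<exists>B\<subseteq>insert x S. card B = Suc j \<and> (\<forall>b\<in>B. h' j \<le> g b))" if "j < Suc ?n" for j
    proof (cases "j = ?n")
      case True
      have "g x \<le> h' 0"
      proof (cases "?n = 0")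
        case False
        hence "h 0 \<in> g ` S" using h(2)[of 0] by simp
        thus ?thesis using insert False by (auto simp: h'_def)
      qed (simp add: h'_def)
      moreover have "card (insert x S) = Suc j" using True False insert by simp
      moreover have "\<forall>b\<in>insert x S. h' j \<le> g b" using insert True by (auto simp: h'_def)
      ultimately show ?thesis using True by (auto simp: h'_def intro!: exI[of _ "insert x S"])
    next
      case False
      hence "j < ?n" using that by simp
      moreover from this have "h' 0 = h 0" "h' j = h j" by (auto simp: h'_def)
      ultimately show ?thesis using h(2)[of j] by (auto intro!: imageI)
    qed
    moreover have "(\<Sum>j<Suc ?n. h' j) = (\<Sum>x\<in>insert x S. g x)"
      using insert False h(1) by (simp add: h'_def)
    ultimately show ?thesis using insert False by (intro exI[of _ h']) simp
  qed
qed simp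

text \<open>Representatives start at \<open>0\<close>, so that modulo \<open>1\<close> the class of
  \<open>0\<close> counts as a unit.\<close>

definition reduced_residues :: "int \<Rightarrow> int set" where
  "reduced_residues q = {a \<in> {0..<q}. coprime a q}"

text \<open>The step along a factor \<open>p\<close>: the four weights will be the restrictions of
  one weight to four fibres. Positive sums give each fibre a unit of positive weight.\<close>

definition local_property :: "int \<Rightarrow> bool" where
  "local_property p \<longleftrightarrow> (\<forall>g1 g2 g3 g4 :: int \<Rightarrow> real. \<forall>x.
     (\<forall>g\<in>{g1, g2, g3, g4}. (\<forall>b\<in>reduced_residues p. g b \<in> {0..1}) \<and> 0 < sum g (reduced_residues p)) \<longrightarrow>
     2 * real (card (reduced_residues p)) <
       sum g1 (reduced_residues p) + sum g2 (reduced_residues p)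
         + sum g3 (reduced_residues p) + sum g4 (reduced_residues p) \<longrightarrow>
     gcd 2 p dvd x \<longrightarrow>
     (\<exists>b1\<in>reduced_residues p. \<exists>b2\<in>reduced_residues p. \<exists>b3\<in>reduced_residues p. \<exists>b4\<in>reduced_residues p.
        0 < g1 b1 \<and> 0 < g2 b2 \<and> 0 < g3 b3 \<and> 0 < g4 b4 \<and> 2 < g1 b1 + g2 b2 + g3 b3 + g4 b4 \<and>
        [b1 + b2 + b3 + b4 = x] (mod p)))"

lemma reduced_residues_2: "reduced_residues 2 = {1}"
  by (auto simp: reduced_residues_def) presburger

lemma local_property_2: "local_property 2"
  by (auto simp: local_property_def reduced_residues_2 cong_def)

text \<open>Only the support is sorted and \<open>s\<close> is its size, so every top segment
  consists of elements of positive weight.\<close>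

lemma ex_support_rearrangement:
  assumes g: "\<And>b. b \<in> X \<Longrightarrow> g b \<in> {0..1::real}" and X: "finite X" and pos: "0 < sum g X"
  obtains s h where "peaked_weights (card X) s h" "(\<Sum>j<s. h j) = sum g X"
    "\<And>j. j < s \<Longrightarrow> \<exists>B\<subseteq>X. card B = Suc j \<and> (\<forall>b\<in>B. 0 < g b \<and> h j \<le> g b)"
proof -
  define Y where "Y = {b \<in> X. 0 < g b}"
  have Y: "finite Y" "Y \<subseteq> X" using X by (auto simp: Y_def)
  have sum: "sum g Y = sum g X"
    using g X by (intro sum.mono_neutral_left) (force simp: Y_def)+
  have "Y \<noteq> {}" using sum pos by auto
  obtain h where h: "(\<Sum>j<card Y. h j) = sum g Y"
    "\<forall>j<card Y. h j \<in> g ` Y \<and> h j \<le> h 0 \<and> (\<exists>B\<subseteq>Y. card B = Suc j \<and> (\<forall>b\<in>B. h j \<le> g b))"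
    using ex_peaked_rearrangement[OF Y(1), of g] by auto
  show ?thesis
  proof (rule that)
    have "0 < h j \<and> h j \<le> h 0 \<and> h j \<le> 1" if "j < card Y" for j
      using h(2) that g by (force simp: Y_def)
    thus "peaked_weights (card X) (card Y) h"
      using Y X \<open>Y \<noteq> {}\<close> by (auto simp: peaked_weights_def card_gt_0_iff intro: card_mono)
    show "(\<Sum>j<card Y. h j) = sum g X" using h sum by simp
    show "\<exists>B\<subseteq>X. card B = Suc j \<and> (\<forall>b\<in>B. 0 < g b \<and> h j \<le> g b)" if "j < card Y" for j
      using h(2) that by (fastforce simp: Y_def)
  qed
qed

lemma finite_reduced_residues [simp]: "finite (reduced_residues q)"
  by (rule finite_subset[OF _ finite_atLeastLessThan_int[of 0 q]]) (auto simp: reduced_residues_def)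

lemma reduced_residues_prime:
  assumes "Factorial_Ring.prime p"
  shows "reduced_residues p = {0<..<p}"
proof -
  have "coprime a p" if "0 < a" "a < p" for a
    using assms that prime_imp_coprime[of p a] zdvd_not_zless[of a p] by (auto simp: coprime_commute)
  moreover have "\<not> coprime 0 p" using assms by auto
  hence "0 < a" if "coprime a p" "0 \<le> a" for a using that by (cases "a = 0") simp_all
  ultimately show ?thesis unfolding reduced_residues_def by fastforce
qed

text \<open>On a top segment of size \<open>j + 1\<close> the weight is at least \<open>h j\<close>;
  hence whichever elements of the four segments represent \<open>x\<close>, their weights add up to
  more than \<open>2\<close>.\<close>

lemma local_property_prime:
  assumes p: "Factorial_Ring.prime p" "5 \<le> p"
  shows "local_property p"
  unfolding local_property_def
proof (intro allI impI)
  fix g1 g2 g3 g4 :: "int \<Rightarrow> real" and x :: int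
  let ?X = "reduced_residues p"
  assume g: "\<forall>g\<in>{g1, g2, g3, g4}. (\<forall>b\<in>?X. g b \<in> {0..1}) \<and> 0 < sum g ?X"
    and gt: "2 * real (card ?X) < sum g1 ?X + sum g2 ?X + sum g3 ?X + sum g4 ?X"
  have X: "finite ?X" "?X \<subseteq> {0..<p}"
    by (simp, auto simp: reduced_residues_def)
  have n: "card ?X = nat p - 1" "3 \<le> card ?X"
    using p by (simp_all add: reduced_residues_prime nat_diff_distrib)
  obtain s1 h1 where 1: "peaked_weights (card ?X) s1 h1" "(\<Sum>j<s1. h1 j) = sum g1 ?X"
    "\<And>j. j < s1 \<Longrightarrow> \<exists>B\<subseteq>?X. card B = Suc j \<and> (\<forall>b\<in>B. 0 < g1 b \<and> h1 j \<le> g1 b)"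
    using ex_support_rearrangement[of ?X g1] g X by auto
  obtain s2 h2 where 2: "peaked_weights (card ?X) s2 h2" "(\<Sum>j<s2. h2 j) = sum g2 ?X"
    "\<And>j. j < s2 \<Longrightarrow> \<exists>B\<subseteq>?X. card B = Suc j \<and> (\<forall>b\<in>B. 0 < g2 b \<and> h2 j \<le> g2 b)"
    using ex_support_rearrangement[of ?X g2] g X by auto
  obtain s3 h3 where 3: "peaked_weights (card ?X) s3 h3" "(\<Sum>j<s3. h3 j) = sum g3 ?X"
    "\<And>j. j < s3 \<Longrightarrow> \<exists>B\<subseteq>?X. card B = Suc j \<and> (\<forall>b\<in>B. 0 < g3 b \<and> h3 j \<le> g3 b)"
    using ex_support_rearrangement[of ?X g3] g X by auto
  obtain s4 h4 where 4: "peaked_weights (card ?X) s4 h4" "(\<Sum>j<s4. h4 j) = sum g4 ?X"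
    "\<And>j. j < s4 \<Longrightarrow> \<exists>B\<subseteq>?X. card B = Suc j \<and> (\<forall>b\<in>B. 0 < g4 b \<and> h4 j \<le> g4 b)"
    using ex_support_rearrangement[of ?X g4] g X by auto
  obtain j1 j2 j3 j4 where j: "j1 < s1" "j2 < s2" "j3 < s3" "j4 < s4"
      "card ?X \<le> j1 + j2 + j3 + j4" "2 < h1 j1 + h2 j2 + h3 j3 + h4 j4"
    using ex_positions_sum_gt_two[OF 1(1) 2(1) 3(1) 4(1) n(2)] gt 1(2) 2(2) 3(2) 4(2) by auto
  obtain B1 where B1: "B1 \<subseteq> ?X" "card B1 = Suc j1" "\<And>b. b \<in> B1 \<Longrightarrow> 0 < g1 b \<and> h1 j1 \<le> g1 b"
    using 1(3)[OF j(1)] by blast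
  obtain B2 where B2: "B2 \<subseteq> ?X" "card B2 = Suc j2" "\<And>b. b \<in> B2 \<Longrightarrow> 0 < g2 b \<and> h2 j2 \<le> g2 b"
    using 2(3)[OF j(2)] by blast
  obtain B3 where B3: "B3 \<subseteq> ?X" "card B3 = Suc j3" "\<And>b. b \<in> B3 \<Longrightarrow> 0 < g3 b \<and> h3 j3 \<le> g3 b"
    using 3(3)[OF j(3)] by blast
  obtain B4 where B4: "B4 \<subseteq> ?X" "card B4 = Suc j4" "\<And>b. b \<in> B4 \<Longrightarrow> 0 < g4 b \<and> h4 j4 \<le> g4 b"
    using 4(3)[OF j(4)] by blast
  have "\<exists>b1\<in>B1. \<exists>b2\<in>B2. \<exists>b3\<in>B3. \<exists>b4\<in>B4. [b1 + b2 + b3 + b4 = x] (mod p)"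
  proof (rule ex_sum4_cong[OF p(1)])
    show "B1 \<subseteq> {0..<p}" "B2 \<subseteq> {0..<p}" "B3 \<subseteq> {0..<p}" "B4 \<subseteq> {0..<p}"
      using B1 B2 B3 B4 X by blast+
    show "B1 \<noteq> {}" "B2 \<noteq> {}" "B3 \<noteq> {}" "B4 \<noteq> {}"
      using B1(2) B2(2) B3(2) B4(2) by auto
    show "nat p + 3 \<le> card B1 + card B2 + card B3 + card B4"
      using B1(2) B2(2) B3(2) B4(2) j(5) n by linarith
  qed
  then obtain b1 b2 b3 b4 where b: "b1 \<in> B1" "b2 \<in> B2" "b3 \<in> B3" "b4 \<in> B4"
    "[b1 + b2 + b3 + b4 = x] (mod p)" by blast
  have "2 < g1 b1 + g2 b2 + g3 b3 + g4 b4"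
    using B1(3)[OF b(1)] B2(3)[OF b(2)] B3(3)[OF b(3)] B4(3)[OF b(4)] j(6) by linarith
  thus "\<exists>b1\<in>?X. \<exists>b2\<in>?X. \<exists>b3\<in>?X. \<exists>b4\<in>?X. 0 < g1 b1 \<and> 0 < g2 b2 \<and> 0 < g3 b3 \<and> 0 < g4 b4 \<and>
      2 < g1 b1 + g2 b2 + g3 b3 + g4 b4 \<and> [b1 + b2 + b3 + b4 = x] (mod p)"
    using b B1 B2 B3 B4 by (meson subset_iff)
qed

section \<open>Weights modulo a square-free number\<close>

text \<open>The induction statement: positivity and the total above \<open>2\<close> in the
  conclusion become the hypotheses of \<open>local_property\<close> on the fibres.\<close>

definition weighted_cover_property :: "int \<Rightarrow> bool" where
  "weighted_cover_property q \<longleftrightarrow> (\<forall>f :: int \<Rightarrow> real. \<forall>x.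
     (\<forall>a\<in>reduced_residues q. f a \<in> {0..1}) \<longrightarrow>
     real (card (reduced_residues q)) < 2 * sum f (reduced_residues q) \<longrightarrow>
     gcd 2 q dvd x \<longrightarrow>
     (\<exists>a1\<in>reduced_residues q. \<exists>a2\<in>reduced_residues q. \<exists>a3\<in>reduced_residues q. \<exists>a4\<in>reduced_residues q.
        0 < f a1 \<and> 0 < f a2 \<and> 0 < f a3 \<and> 0 < f a4 \<and> 2 < f a1 + f a2 + f a3 + f a4 \<and>
        [a1 + a2 + a3 + a4 = x] (mod q)))"

text \<open>The Chinese remainder theorem: for fixed \<open>a\<close>, \<open>c a\<close> enumerates
  the fibre over \<open>a\<close> of reduction modulo \<open>q\<close>.\<close>

lemma ex_bij_betw_reduced_residues_mult:
  fixes p q :: int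
  assumes pos: "p > 0" "q > 0" and cop: "coprime p q"
  obtains c where "bij_betw (\<lambda>(a, b). c a b) (reduced_residues q \<times> reduced_residues p) (reduced_residues (p * q))"
    "\<And>a b. [c a b = a] (mod q)" "\<And>a b. [c a b = b] (mod p)"
proof -
  have "\<exists>x. x \<in> {0..<p * q} \<and> [x = a] (mod q) \<and> [x = b] (mod p)" for a b
  proof -
    obtain y where y: "[y = b] (mod p)" "[y = a] (mod q)"
      using binary_chinese_remainder_int[OF cop] by blast
    have "[y mod (p * q) = b] (mod p)" "[y mod (p * q) = a] (mod q)"
      using y by (simp_all add: cong_def mod_mod_cancel)
    thus ?thesis using pos by (intro exI[of _ "y mod (p * q)"]) auto
  qed
  then obtain c where c: "\<And>a b. c a b \<in> {0..<p * q} \<and> [c a b = a] (mod q) \<and> [c a b = b] (mod p)"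
    by metis
  show ?thesis
  proof (rule that)
    show "bij_betw (\<lambda>(a, b). c a b) (reduced_residues q \<times> reduced_residues p) (reduced_residues (p * q))"
    proof (rule bij_betw_byWitness[where f' = "\<lambda>x. (x mod q, x mod p)"])
      show "\<forall>ab\<in>reduced_residues q \<times> reduced_residues p.
          ((case ab of (a, b) \<Rightarrow> c a b) mod q, (case ab of (a, b) \<Rightarrow> c a b) mod p) = ab"
        using c by (auto simp: reduced_residues_def cong_def)
      show "\<forall>x\<in>reduced_residues (p * q). (case (x mod q, x mod p) of (a, b) \<Rightarrow> c a b) = x"
      proof
        fix x assume x: "x \<in> reduced_residues (p * q)"
        have "[c (x mod q) (x mod p) = x] (mod p)" "[c (x mod q) (x mod p) = x] (mod q)"
          using c[of "x mod q" "x mod p"] by (simp_all add: cong_def)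
        hence "[c (x mod q) (x mod p) = x] (mod (p * q))" using cop by (intro coprime_cong_mult)
        thus "(case (x mod q, x mod p) of (a, b) \<Rightarrow> c a b) = x"
          using x c[of "x mod q" "x mod p"] by (auto simp: cong_def reduced_residues_def)
      qed
      have "coprime (c a b) (p * q)" if "coprime a q" "coprime b p" for a b
      proof -
        have "coprime (c a b) q" "coprime (c a b) p"
          using that c[of a b] cong_imp_coprime cong_sym by blast+
        thus ?thesis by simp
      qed
      thus "(\<lambda>(a, b). c a b) ` (reduced_residues q \<times> reduced_residues p) \<subseteq> reduced_residues (p * q)"
        using c by (auto simp: reduced_residues_def)
      show "(\<lambda>x. (x mod q, x mod p)) ` reduced_residues (p * q) \<subseteq> reduced_residues q \<times> reduced_residues p"
        using pos by (auto simp: reduced_residues_def)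
    qed
  qed (use c in auto)
qed

lemma reduced_residues_nonempty: "q > 0 \<Longrightarrow> reduced_residues q \<noteq> {}"
proof -
  assume "q > 0"
  hence "1 mod q \<in> reduced_residues q" by (cases "q = 1") (auto simp: reduced_residues_def)
  thus ?thesis by auto
qed

lemma weighted_cover_property_mult:
  assumes pos: "p > 0" "q > 0" and cop: "coprime p q"
    and p: "local_property p" and q: "weighted_cover_property q"
  shows "weighted_cover_property (p * q)"
  unfolding weighted_cover_property_def
proof (intro allI impI)
  fix f :: "int \<Rightarrow> real" and x :: int
  let ?P = "reduced_residues p" and ?Q = "reduced_residues q" and ?N = "reduced_residues (p * q)"
  assume f01: "\<forall>a\<in>?N. f a \<in> {0..1}" and dense: "real (card ?N) < 2 * sum f ?N" and x: "gcd 2 (p * q) dvd x"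
  obtain c where bij: "bij_betw (\<lambda>(a, b). c a b) (?Q \<times> ?P) ?N"
    and c: "\<And>a b. [c a b = a] (mod q)" "\<And>a b. [c a b = b] (mod p)"
    using ex_bij_betw_reduced_residues_mult[OF pos cop] by blast
  have cN: "c a b \<in> ?N" if "a \<in> ?Q" "b \<in> ?P" for a b
    using bij that by (auto simp: bij_betw_def)
  have cardP: "card ?P > 0" using reduced_residues_nonempty[OF pos(1)] by (simp add: card_gt_0_iff)
  \<comment> \<open>The mean of \<open>f\<close> over the fibre over \<open>a\<close>. All fibres
    have the same size, so \<open>F\<close> has the same mean as \<open>f\<close>.\<close>
  define F where "F a = (\<Sum>b\<in>?P. f (c a b)) / card ?P" for a
  have F01: "F a \<in> {0..1}" if "a \<in> ?Q" for a
  proof -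
    have "(\<Sum>b\<in>?P. f (c a b)) \<le> real (card ?P) * 1"
      using f01 cN that by (intro sum_bounded_above) auto
    moreover have "0 \<le> (\<Sum>b\<in>?P. f (c a b))" using f01 cN that by (intro sum_nonneg) auto
    ultimately show ?thesis using cardP by (simp add: F_def)
  qed
  have "card ?N = card ?Q * card ?P"
    using bij_betw_same_card[OF bij] by (simp add: card_cartesian_product)
  moreover have "sum f ?N = (\<Sum>a\<in>?Q. \<Sum>b\<in>?P. f (c a b))"
    using sum.reindex_bij_betw[OF bij, of f] by (simp add: sum.cartesian_product case_prod_unfold)
  hence "sum f ?N = sum F ?Q * card ?P"
    using cardP by (simp add: F_def sum_divide_distrib[symmetric])
  ultimately have "real (card ?Q) * real (card ?P) < (2 * sum F ?Q) * real (card ?P)" using dense by simp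
  hence F_dense: "real (card ?Q) < 2 * sum F ?Q" by (rule mult_right_less_imp_less) simp
  have gcd_dvd: "gcd 2 q dvd x" "gcd 2 p dvd x"
    using x by (meson dvd_trans dvd_triv_left dvd_triv_right gcd_mono dvd_refl)+
  obtain a1 a2 a3 a4 where a: "a1 \<in> ?Q" "a2 \<in> ?Q" "a3 \<in> ?Q" "a4 \<in> ?Q"
    and Fa: "0 < F a1" "0 < F a2" "0 < F a3" "0 < F a4" "2 < F a1 + F a2 + F a3 + F a4"
    and a_sum: "[a1 + a2 + a3 + a4 = x] (mod q)"
    using q[unfolded weighted_cover_property_def, rule_format, OF F01 F_dense gcd_dvd(1)] by blast
  \<comment> \<open>Multiplying by the fibre size turns the four means back into sums over the
    fibres.\<close>
  have "2 * real (card ?P) < real (card ?P) * (F a1 + F a2 + F a3 + F a4)"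
    using Fa(5) cardP by simp
  hence gt: "2 * real (card ?P) < (\<Sum>b\<in>?P. f (c a1 b)) + (\<Sum>b\<in>?P. f (c a2 b))
      + (\<Sum>b\<in>?P. f (c a3 b)) + (\<Sum>b\<in>?P. f (c a4 b))"
    using reduced_residues_nonempty[OF pos(1)] by (simp add: F_def distrib_left)
  have g: "\<forall>g\<in>{\<lambda>b. f (c a1 b), \<lambda>b. f (c a2 b), \<lambda>b. f (c a3 b), \<lambda>b. f (c a4 b)}.
      (\<forall>b\<in>?P. g b \<in> {0..1}) \<and> 0 < sum g ?P"
    using Fa(1-4) f01 cN a cardP by (auto simp: F_def zero_less_divide_iff)
  obtain b1 b2 b3 b4 where b: "b1 \<in> ?P" "b2 \<in> ?P" "b3 \<in> ?P" "b4 \<in> ?P"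
    and fc: "0 < f (c a1 b1)" "0 < f (c a2 b2)" "0 < f (c a3 b3)" "0 < f (c a4 b4)"
      "2 < f (c a1 b1) + f (c a2 b2) + f (c a3 b3) + f (c a4 b4)"
    and b_sum: "[b1 + b2 + b3 + b4 = x] (mod p)"
    using p[unfolded local_property_def, THEN spec, THEN spec, THEN spec, THEN spec, THEN spec,
        THEN mp, OF g, THEN mp, OF gt, THEN mp, OF gcd_dvd(2)] by blast
  have "[c a1 b1 + c a2 b2 + c a3 b3 + c a4 b4 = a1 + a2 + a3 + a4] (mod q)"
    "[c a1 b1 + c a2 b2 + c a3 b3 + c a4 b4 = b1 + b2 + b3 + b4] (mod p)"
    by (intro cong_add c)+
  hence "[c a1 b1 + c a2 b2 + c a3 b3 + c a4 b4 = x] (mod (p * q))"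
    using a_sum b_sum cop by (intro coprime_cong_mult) (auto intro: cong_trans)
  thus "\<exists>a1\<in>?N. \<exists>a2\<in>?N. \<exists>a3\<in>?N. \<exists>a4\<in>?N. 0 < f a1 \<and> 0 < f a2 \<and> 0 < f a3 \<and> 0 < f a4 \<and>
      2 < f a1 + f a2 + f a3 + f a4 \<and> [a1 + a2 + a3 + a4 = x] (mod (p * q))"
    using cN a b fc by blast
qed

lemma reduced_residues_1: "reduced_residues 1 = {0}"
  by (auto simp: reduced_residues_def)

lemma reduced_residues_3: "reduced_residues 3 = {1, 2}"
proof -
  have "reduced_residues 3 = {0<..<3}" by (rule reduced_residues_prime) simp
  also have "\<dots> = {1, 2}" by force
  finally show ?thesis .
qed

lemma weighted_cover_property_1: "weighted_cover_property 1"
  by (auto simp: weighted_cover_property_def reduced_residues_1 cong_def)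

text \<open>Both weights are positive as each is at most \<open>1\<close> and their sum exceeds
  \<open>1\<close>. The residue \<open>0\<close> is \<open>1 + 1 + 2 + 2\<close>; each other residue
  has two representations, and the one that uses the heavier unit more often has weight above
  \<open>2\<close>.\<close>

lemma weighted_cover_property_3: "weighted_cover_property 3"
  unfolding weighted_cover_property_def
proof (intro allI impI)
  fix f :: "int \<Rightarrow> real" and x :: int
  assume "\<forall>a\<in>reduced_residues 3. f a \<in> {0..1}"
    and "real (card (reduced_residues 3)) < 2 * sum f (reduced_residues 3)"
  hence f: "0 < f 1" "0 < f 2" "1 < f 1 + f 2" by (auto simp: reduced_residues_3)
  let ?goal = "\<lambda>a1 a2 a3 a4. 0 < f a1 \<and> 0 < f a2 \<and> 0 < f a3 \<and> 0 < f a4 \<and>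
      2 < f a1 + f a2 + f a3 + f a4 \<and> [a1 + a2 + a3 + a4 = x] (mod 3)"
  consider "x mod 3 = 0" | "x mod 3 = 1" "f 1 \<ge> f 2" | "x mod 3 = 1" "f 2 \<ge> f 1"
    | "x mod 3 = 2" "f 1 \<ge> f 2" | "x mod 3 = 2" "f 2 \<ge> f 1"
    using linear[of "f 1" "f 2"] by linarith
  hence "?goal 1 1 2 2 \<or> ?goal 1 1 1 1 \<or> ?goal 1 2 2 2 \<or> ?goal 1 1 1 2 \<or> ?goal 2 2 2 2"
    by cases (use f in \<open>simp_all add: cong_def\<close>)
  thus "\<exists>a1\<in>reduced_residues 3. \<exists>a2\<in>reduced_residues 3. \<exists>a3\<in>reduced_residues 3. \<exists>a4\<in>reduced_residues 3.
      ?goal a1 a2 a3 a4"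
    unfolding reduced_residues_3 by blast
qed

text \<open>Primes other than \<open>3\<close> are split off as long as there are any;
  square-freeness leaves \<open>1\<close> or \<open>3\<close> as the base.\<close>

theorem weighted_cover_property_squarefree:
  fixes q :: nat
  assumes "squarefree q" "q > 0"
  shows "weighted_cover_property (int q)"
  using assms
proof (induction q rule: less_induct)
  case (less q)
  show ?case
  proof (cases "\<exists>p. Factorial_Ring.prime p \<and> p dvd q \<and> p \<noteq> 3")
    case True
    then obtain p r where p: "Factorial_Ring.prime p" "p \<noteq> 3" and q: "q = p * r" by (auto elim: dvdE)
    have "\<not> p dvd r"
    proof
      assume "p dvd r"
      hence "p ^ 2 dvd q" using q by (simp add: power2_eq_square)
      thus False using less.prems(1) p by (auto simp: squarefree_def)
    qed
    hence sf: "squarefree r" "coprime p r"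
      using less.prems(1) q p prime_imp_coprime squarefree_multD by blast+
    have r: "0 < r" "r < q" using less.prems q p prime_gt_1_nat by auto
    have "local_property (int p)"
    proof (cases "p = 2")
      case False
      have "p \<noteq> 4" using p by auto
      hence "5 \<le> int p" using False p(2) prime_ge_2_nat[OF p(1)] by linarith
      thus ?thesis using p by (intro local_property_prime) auto
    qed (simp add: local_property_2)
    hence "weighted_cover_property (int p * int r)"
      using less.IH[OF r(2) sf(1) r(1)] sf r p prime_gt_0_nat
      by (intro weighted_cover_property_mult) auto
    thus ?thesis by (simp add: q)
  next
    case False
    show ?thesis
    proof (cases "q = 1")
      case ne: False
      then obtain p where p: "Factorial_Ring.prime p" "p dvd q" using prime_factor_nat by blast
      with False obtain r where q: "q = 3 * r" by (auto elim: dvdE)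
      \<comment> \<open>A prime factor of \<open>r\<close> divides \<open>q\<close>, hence is
        \<open>3\<close>, and then \<open>9\<close> would divide \<open>q\<close>.\<close>
      have "r = 1"
      proof (rule ccontr)
        assume "r \<noteq> 1"
        then obtain p' where "Factorial_Ring.prime p'" "p' dvd r" using prime_factor_nat by blast
        moreover from this have "p' dvd q" using q by simp
        ultimately have "3 dvd r" using False by blast
        hence "3 ^ 2 dvd q" using q by (auto simp: power2_eq_square)
        hence "is_unit (3 :: nat)" by (rule squarefreeD[OF less.prems(1)])
        thus False by simp
      qed
      thus ?thesis using q weighted_cover_property_3 by simp
    qed (simp add: weighted_cover_property_1)
  qed
qed

section \<open>Transfer to the residue ring\<close>

text \<open>For \<open>q = 1\<close> the sets differ, \<open>{0}\<close> against
  \<open>totatives 1 = {1}\<close>, but their sizes agree.\<close>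

lemma card_reduced_residues: "q > 0 \<Longrightarrow> card (reduced_residues (int q)) = totient q"
proof (cases "q = 1")
  case False
  assume "q > 0"
  with False have "reduced_residues (int q) = int ` totatives q"
  proof (intro equalityI subsetI)
    fix a assume a: "a \<in> reduced_residues (int q)"
    with False have "a \<noteq> 0" by (auto simp: reduced_residues_def)
    with a have "nat a \<in> totatives q" "a = int (nat a)"
      by (auto simp: reduced_residues_def in_totatives_iff nat_le_iff coprime_int_iff[symmetric])
    thus "a \<in> int ` totatives q" by blast
  next
    fix a assume "a \<in> int ` totatives q"
    thus "a \<in> reduced_residues (int q)"
      using False \<open>q > 0\<close> totatives_less[of _ q] by (auto simp: reduced_residues_def in_totatives_iff)
  qed
  thus ?thesis by (simp add: card_image totient_def)
qed (simp add: reduced_residues_1)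

text \<open>Up to eta-expansion \<open>ZMod k\<close> is the quotient map of the ideal generated by
  \<open>k\<close>.\<close>

lemma ZMod_hom: "ring_hom_ring \<Z> (ZFact k) (ZMod k)"
proof -
  interpret ideal "Idl\<^bsub>\<Z>\<^esub> {k}" \<Z> by (rule int.genideal_ideal) simp
  have "ZMod k = (+>\<^bsub>\<Z>\<^esub>) (Idl\<^bsub>\<Z>\<^esub> {k})" by (rule ext) (simp add: ZMod_def)
  thus ?thesis using rcos_ring_hom_ring by (simp add: ZFact_def)
qed

lemma carrier_ZFact: "carrier (ZFact k) = range (ZMod k)"
  by (auto simp: ZFact_def FactRing_def A_RCOSETS_def' ZMod_def)

lemma ZMod_add: "ZMod k a \<oplus>\<^bsub>ZFact k\<^esub> ZMod k b = ZMod k (a + b)"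
  using ring_hom_add[OF ring_hom_ring.homh[OF ZMod_hom], of a b k] by simp

lemma mem_ZMod_iff: "n \<in> ZMod k a \<longleftrightarrow> [n = a] (mod k)"
proof -
  interpret ideal "Idl\<^bsub>\<Z>\<^esub> {k}" \<Z> by (rule int.genideal_ideal) simp
  have "n \<in> ZMod k a \<longleftrightarrow> ZMod k n = ZMod k a"
    using a_repr_independence'[of n a] a_rcos_self[of n] by (auto simp: ZMod_def)
  thus ?thesis by (simp add: ZMod_eq_mod cong_def)
qed

lemma Units_ZFact_imp_coprime:
  assumes "ZMod k a \<in> Units (ZFact k)"
  shows "coprime a k"
proof -
  obtain b where "ZMod k a \<otimes>\<^bsub>ZFact k\<^esub> ZMod k b = \<one>\<^bsub>ZFact k\<^esub>"
    using assms by (auto simp: Units_def carrier_ZFact)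
  hence "ZMod k (a * b) = ZMod k 1"
    using ring_hom_mult[OF ring_hom_ring.homh[OF ZMod_hom], of a b k]
      ring_hom_one[OF ring_hom_ring.homh[OF ZMod_hom], of k] by simp
  hence "[a * b = 1] (mod k)" by (simp add: ZMod_eq_mod cong_def)
  thus ?thesis by (metis coprime_iff_invertible_int)
qed

theorem theorem1p2:
  fixes q :: nat and A :: "int set set"
  assumes "q > 0" and "squarefree q"
    and "A \<subseteq> Units (ZFact (int q))"
    and "real (card A) > 1 / 2 * real (totient q)"
  shows "A <+>\<^bsub>ZFact (int q)\<^esub> A <+>\<^bsub>ZFact (int q)\<^esub> A <+>\<^bsub>ZFact (int q)\<^esub> A
    = {a \<in> carrier (ZFact (int q)). \<forall>n\<in>a. [n = 0] (mod gcd 2 (int q))}"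
proof -
  let ?R = "reduced_residues (int q)" and ?cls = "ZMod (int q)"
  have A: "\<exists>a\<in>?R. S = ?cls a" if "S \<in> A" for S
  proof -
    have "S \<in> Units (ZFact (int q))" using that assms(3) by blast
    then obtain a where "S = ?cls a" by (auto simp: Units_def carrier_ZFact)
    hence S: "S = ?cls (a mod int q)" using ZMod_mod by simp
    hence "coprime (a mod int q) (int q)"
      using \<open>S \<in> Units _\<close> Units_ZFact_imp_coprime by blast
    hence "a mod int q \<in> ?R" using assms(1) by (simp add: reduced_residues_def)
    thus ?thesis using S by blast
  qed
  \<comment> \<open>The representatives in \<open>?R\<close> of the classes in \<open>A\<close>, one
    for each class.\<close>
  define R where "R = {a \<in> ?R. ?cls a \<in> A}"
  have "A = ?cls ` R" using A by (auto simp: R_def)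
  moreover have "inj_on ?cls R"
    by (auto simp: inj_on_def R_def ZMod_eq_mod reduced_residues_def)
  ultimately have card: "card A = card R" by (simp add: card_image)
  \<comment> \<open>The indicator weight: its sum is the size of \<open>A\<close>, and positive
    weight means membership in \<open>A\<close>.\<close>
  define f where "f a = (if ?cls a \<in> A then 1 else 0 :: real)" for a
  have "sum f ?R = real (card A)"
    by (simp add: card f_def R_def sum.If_cases Int_def)
  hence dense: "real (card ?R) < 2 * sum f ?R"
    using assms(1,4) by (simp add: card_reduced_residues)
  have sum4: "S \<in> A <+>\<^bsub>ZFact (int q)\<^esub> A <+>\<^bsub>ZFact (int q)\<^esub> A <+>\<^bsub>ZFact (int q)\<^esub> A
      \<longleftrightarrow> (\<exists>S1\<in>A. \<exists>S2\<in>A. \<exists>S3\<in>A. \<exists>S4\<in>A.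
        S = S1 \<oplus>\<^bsub>ZFact (int q)\<^esub> S2 \<oplus>\<^bsub>ZFact (int q)\<^esub> S3 \<oplus>\<^bsub>ZFact (int q)\<^esub> S4)" for S
    by (simp add: set_add_def')
  have covers: "?cls x \<in> A <+>\<^bsub>ZFact (int q)\<^esub> A <+>\<^bsub>ZFact (int q)\<^esub> A <+>\<^bsub>ZFact (int q)\<^esub> A"
    if gx: "gcd 2 (int q) dvd x" for x
  proof -
    have f01: "f a \<in> {0..1}" for a by (simp add: f_def)
    obtain a1 a2 a3 a4 where f: "0 < f a1" "0 < f a2" "0 < f a3" "0 < f a4"
      and x: "[a1 + a2 + a3 + a4 = x] (mod int q)"
      using weighted_cover_property_squarefree[OF assms(2,1), unfolded weighted_cover_property_def,
          rule_format, OF f01 dense gx] by blast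
    have "?cls x = ?cls a1 \<oplus>\<^bsub>ZFact (int q)\<^esub> ?cls a2 \<oplus>\<^bsub>ZFact (int q)\<^esub> ?cls a3 \<oplus>\<^bsub>ZFact (int q)\<^esub> ?cls a4"
      using x by (simp add: ZMod_add ZMod_eq_mod cong_def)
    moreover have "?cls a1 \<in> A" "?cls a2 \<in> A" "?cls a3 \<in> A" "?cls a4 \<in> A"
      using f by (auto simp: f_def split: if_splits)
    ultimately show ?thesis unfolding sum4 by blast
  qed
  \<comment> \<open>For even \<open>q\<close> units are odd and four odd numbers have an even sum;
    for odd \<open>q\<close> the modulus is \<open>1\<close>.\<close>
  have even: "[n = 0] (mod gcd 2 (int q))"
    if "n \<in> ?cls (a1 + a2 + a3 + a4)" "a1 \<in> ?R" "a2 \<in> ?R" "a3 \<in> ?R" "a4 \<in> ?R" for n a1 a2 a3 a4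
  proof (cases "even q")
    case True
    have "odd a" if "a \<in> ?R" for a
      using that True by (auto simp: reduced_residues_def dest: coprime_common_divisor[where c = 2])
    moreover have "[n = a1 + a2 + a3 + a4] (mod 2)"
      using that(1) True by (auto simp: mem_ZMod_iff intro: cong_dvd_modulus)
    ultimately have "even n" using that(2-) by (auto simp: cong_def)
    thus ?thesis using cong_dvd_modulus[of n 0 2] by (simp add: cong_0_iff dvd_trans[OF gcd_dvd1])
  next
    case False
    hence "gcd 2 (int q) = 1" by (simp flip: coprime_iff_gcd_eq_1)
    thus ?thesis by simp
  qed
  show ?thesis
  proof (intro equalityI subsetI)
    fix S assume "S \<in> A <+>\<^bsub>ZFact (int q)\<^esub> A <+>\<^bsub>ZFact (int q)\<^esub> A <+>\<^bsub>ZFact (int q)\<^esub> A"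
    then obtain S1 S2 S3 S4 where "S1 \<in> A" "S2 \<in> A" "S3 \<in> A" "S4 \<in> A"
      and "S = S1 \<oplus>\<^bsub>ZFact (int q)\<^esub> S2 \<oplus>\<^bsub>ZFact (int q)\<^esub> S3 \<oplus>\<^bsub>ZFact (int q)\<^esub> S4"
      unfolding sum4 by blast
    moreover from this obtain a1 a2 a3 a4 where "a1 \<in> ?R" "a2 \<in> ?R" "a3 \<in> ?R" "a4 \<in> ?R"
      and "S1 = ?cls a1" "S2 = ?cls a2" "S3 = ?cls a3" "S4 = ?cls a4"
      using A by metis
    ultimately show "S \<in> {a \<in> carrier (ZFact (int q)). \<forall>n\<in>a. [n = 0] (mod gcd 2 (int q))}"
      using even by (auto simp: carrier_ZFact ZMod_add)
  next
    fix S assume S: "S \<in> {a \<in> carrier (ZFact (int q)). \<forall>n\<in>a. [n = 0] (mod gcd 2 (int q))}"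
    then obtain x where x: "S = ?cls x" by (auto simp: carrier_ZFact)
    have "x \<in> S" by (simp add: x mem_ZMod_iff)
    hence "gcd 2 (int q) dvd x" using S by (auto simp: cong_0_iff)
    thus "S \<in> A <+>\<^bsub>ZFact (int q)\<^esub> A <+>\<^bsub>ZFact (int q)\<^esub> A <+>\<^bsub>ZFact (int q)\<^esub> A"
      using covers x by blast
  qed
qed

end
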